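(* Let $N\in\{3,4,5,6,8\}$. Suppose the charges are at a fixed-scalar (attractor) point: the antisymmetric matrix $Z_{AB}$ has exactly one nonzero skew-eigenvalue $Z_1$ (all other skew-eigenvalues vanish), the matter charges $Z_I$ vanish (for $N=3,4$), and the singlet charge $X$ vanishes (for $N=6$). Then: (i) the potential $V=\frac12Z_{AB}\bar Z^{AB}+Z_I\bar Z^I$ (with $Z_I\bar Z^I$ replaced by $X\bar X$ for $N=6$ and absent for $N=5,8$) is extremized: $\delta V=0$ under all the coset transformations $\delta$ listed in the context; (ii) the U-duality invariant $S$ listed in the context equals the value of the potential and the squared BPS mass: $S=V=|Z_1|^2$.
   Context: $Z_{AB}=-Z_{BA}$ ($A,B=1,\dots,N$) is a complex matrix (the central charges); by a unitary change of basis $Z\mapsto uZu^t$ it can be put in normal form with $2\times2$ antisymmetric blocks $\begin{pmatrix}0&Z_\alpha\\-Z_\alpha&0\end{pmatrix}$, $\alpha=1,\dots,[N/2]$ (plus a zero for odd $N$), and the $Z_\alpha$ (determined up to phases and order) are the skew-eigenvalues. The BPS (ADM) mass is $|Z_1|$. Bars denote complex conjugates, with $\bar Z^{AB}=(Z_{AB})^*$, $\bar Z^I=(Z_I)^*$; repeated indices are summed; $\epsilon$ is the totally antisymmetric symbol with $\epsilon_{12\cdots}=\epsilon^{12\cdots}=1$; $A_A{}^B=Z_{AC}\bar Z^{CB}$; $\mathrm{Pf}$ is the Pfaffian. $\delta$ acts as a derivation commuting with conjugation. Coset transformations and invariants: $N=3$ (charges $Z_{AB}=\epsilon_{ABC}Z^C$,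 $\bar Z_A=(Z^A)^*$, and $Z_I$, $I=1,\dots,n$): $\delta Z^A=\xi^A_I\bar Z^I$, $\delta Z_I=\xi^A_I\bar Z_A$, with arbitrary complex $\xi^A_I$; $S=Z^A\bar Z_A-Z_I\bar Z^I$. $N=4$ ($Z_I$, $I=1,\dots,n$): $\delta Z_{AB}=\frac12\xi\epsilon_{ABCD}\bar Z^{CD}+\xi_{AB\,I}\bar Z^I$, $\delta Z_I=\bar\xi\bar Z^I+\frac12\xi_{AB\,I}\bar Z^{AB}$, with $\xi\in\mathbb C$ and antisymmetric $\xi_{AB\,I}$ obeying $\overline{\xi_{AB\,I}}=\frac12\epsilon^{ABCD}\xi_{CD\,I}$; $S=\sqrt{I_1^2-|I_2|^2}$, $I_1=\frac12Z_{AB}\bar Z^{AB}-Z_I\bar Z^I$, $I_2=\frac14\epsilon^{ABCD}Z_{AB}Z_{CD}-\sum_I\bar Z^I\bar Z^I$. $N=5$: $\delta Z_{AB}=\frac12\xi^C\epsilon_{CABPQ}\bar Z^{PQ}$, with $\xi\in\mathbb C^5$; $S=\frac12\sqrt{4\mathrm{Tr}(A^2)-(\mathrm{Tr}A)^2}$. $N=6$ (extra singlet charge $X\in\mathbb C$): $\delta Z_{AB}=\frac14\epsilon_{ABCDEF}\overline{\xi_{CD}}\bar Z^{EF}+\xi_{AB}\bar X$, $\delta X=\frac12\xi_{AB}\bar Z^{AB}$, with complex antisymmetric $\xi_{AB}$; $S=\frac12\sqrt{4\mathrm{Tr}(A^2)-(\mathrm{Tr}A)^2+32\,\mathrm{Re}(X\,\mathrm{Pf}Z)+4(\mathrm{Tr}A)X\bar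 X+4X^2\bar X^2}$. $N=8$: $\delta Z_{AB}=\frac12\xi_{ABCD}\bar Z^{CD}$, with totally antisymmetric $\xi_{ABCD}=\frac1{24}\epsilon_{ABCDEFGH}\overline{\xi_{EFGH}}$; $S=\frac12\sqrt{4\mathrm{Tr}(A^2)-(\mathrm{Tr}A)^2+32\,\mathrm{Re}(\mathrm{Pf}Z)}$. *)

theory Defs
  imports "Jordan_Normal_Form.Matrix" "HOL-Combinatorics.Permutations" Complex_Main
begin

(* All tensor indices are shifted to start at 0: the values 1, ..., N of an index A become
   0, ..., N - 1, and likewise for the indices I and alpha.  Thus the normalisation of
   the epsilon symbol reads: eps [0, 1, ..., N - 1] = 1. *)

definition eps :: "nat list \<Rightarrow> complex" where
  "eps xs = (if distinct xs \<and> set xs = {0..<length xs}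
     then of_int (sign (\<lambda>i. if i < length xs then xs ! i else i)) else 0)"

definition mat_trace :: "complex mat \<Rightarrow> complex" where
  "mat_trace M = (\<Sum>i<dim_row M. M $$ (i, i))"

definition cnj_mat :: "complex mat \<Rightarrow> complex mat" where
  "cnj_mat M = map_mat cnj M"

definition antisym_mat :: "nat \<Rightarrow> complex mat \<Rightarrow> bool" where
  "antisym_mat N M \<longleftrightarrow> M \<in> carrier_mat N N \<and> transpose_mat M = - M"

definition unitary_mat :: "nat \<Rightarrow> complex mat \<Rightarrow> bool" where
  "unitary_mat N u \<longleftrightarrow> u \<in> carrier_mat N N \<and> u * transpose_mat (cnj_mat u) = 1\<^sub>m N
     \<and> transpose_mat (cnj_mat u) * u = 1\<^sub>m N"

(* The Pfaffian of a 2m x 2m matrix, as a sum over all permutations. *)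
definition Pf :: "complex mat \<Rightarrow> complex" where
  "Pf M = (let m = dim_row M div 2 in
     (\<Sum>p | p permutes {0..<2 * m}.
        of_int (sign p) * (\<Prod>i<m. M $$ (p (2 * i), p (2 * i + 1)))) / (2 ^ m * fact m))"

(* Blocks (0, z_a; - z_a, 0) along the diagonal; for odd N the last row and column vanish. *)
definition normal_form :: "nat \<Rightarrow> complex list \<Rightarrow> complex mat" where
  "normal_form N zs = mat N N (\<lambda>(i, j).
     if even i \<and> j = i + 1 then zs ! (i div 2)
     else if even j \<and> i = j + 1 then - (zs ! (j div 2))
     else 0)"

definition skew_eigenvalues :: "nat \<Rightarrow> complex mat \<Rightarrow> complex list \<Rightarrow> bool" where
  "skew_eigenvalues N Z zs \<longleftrightarrow> length zs = N div 2 \<and>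
     (\<exists>u. unitary_mat N u \<and> u * Z * transpose_mat u = normal_form N zs)"

(* The order of the skew-eigenvalues is immaterial, so the nonzero one, z1, may sit at any
   position k. *)
definition single_skew_eigenvalue :: "nat \<Rightarrow> complex mat \<Rightarrow> complex \<Rightarrow> bool" where
  "single_skew_eigenvalue N Z z1 \<longleftrightarrow> z1 \<noteq> 0 \<and>
     (\<exists>zs k. skew_eigenvalues N Z zs \<and> k < N div 2 \<and> zs ! k = z1 \<and>
        (\<forall>a < N div 2. a \<noteq> k \<longrightarrow> zs ! a = 0))"

definition Amat :: "complex mat \<Rightarrow> complex mat" where
  "Amat Z = Z * cnj_mat Z"

(* The potentials and the invariants S below are real quantities, but they are kept
   complex-valued, so that no real parts have to be inserted into the formulas; csqrt is the
   principal branch and agrees with the real square root on nonnegative reals.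

   delta is a derivation on functions of the charges and their conjugates, and it commutes with
   conjugation.  Hence delta V is the derivative at t = 0, for real t, of V evaluated at the
   charges q + t * (delta q). *)

definition V_grav :: "complex mat \<Rightarrow> complex" where
  "V_grav Z = 1/2 * (\<Sum>A<dim_row Z. \<Sum>B<dim_col Z. Z $$ (A, B) * cnj (Z $$ (A, B)))"

definition V_matter :: "complex mat \<Rightarrow> complex vec \<Rightarrow> complex" where
  "V_matter Z W = V_grav Z + (\<Sum>I<dim_vec W. W $ I * cnj (W $ I))"

definition V_singlet :: "complex mat \<Rightarrow> complex \<Rightarrow> complex" where
  "V_singlet Z X = V_grav Z + X * cnj X"

subsection \<open>N = 3\<close>

definition Zmat3 :: "complex vec \<Rightarrow> complex mat" where
  "Zmat3 z = mat 3 3 (\<lambda>(A, B). \<Sum>C<3. eps [A, B, C] * z $ C)"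

(* The entry (A, I) of the matrix xi is the parameter with upper index A and lower index I. *)
definition dZ3 :: "complex mat \<Rightarrow> complex vec \<Rightarrow> complex vec" where
  "dZ3 xi W = vec 3 (\<lambda>A. \<Sum>I<dim_vec W. xi $$ (A, I) * cnj (W $ I))"

definition dW3 :: "complex mat \<Rightarrow> complex vec \<Rightarrow> complex vec" where
  "dW3 xi z = vec (dim_col xi) (\<lambda>I. \<Sum>A<3. xi $$ (A, I) * cnj (z $ A))"

definition S3 :: "complex vec \<Rightarrow> complex vec \<Rightarrow> complex" where
  "S3 z W = (\<Sum>A<3. z $ A * cnj (z $ A)) - (\<Sum>I<dim_vec W. W $ I * cnj (W $ I))"

subsection \<open>N = 4\<close>

definition matter_params4 :: "nat \<Rightarrow> (nat \<Rightarrow> nat \<Rightarrow> nat \<Rightarrow> complex) \<Rightarrow> bool" where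
  "matter_params4 n eta \<longleftrightarrow> (\<forall>A<4. \<forall>B<4. \<forall>I<n.
     eta A B I = - eta B A I \<and>
     cnj (eta A B I) = 1/2 * (\<Sum>C<4. \<Sum>D<4. eps [A, B, C, D] * eta C D I))"

definition dZ4 :: "complex \<Rightarrow> (nat \<Rightarrow> nat \<Rightarrow> nat \<Rightarrow> complex) \<Rightarrow> complex mat \<Rightarrow> complex vec \<Rightarrow> complex mat" where
  "dZ4 xi eta Z W = mat 4 4 (\<lambda>(A, B).
     1/2 * xi * (\<Sum>C<4. \<Sum>D<4. eps [A, B, C, D] * cnj (Z $$ (C, D)))
     + (\<Sum>I<dim_vec W. eta A B I * cnj (W $ I)))"

definition dW4 :: "complex \<Rightarrow> (nat \<Rightarrow> nat \<Rightarrow> nat \<Rightarrow> complex) \<Rightarrow> complex mat \<Rightarrow> complex vec \<Rightarrow> complex vec" where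
  "dW4 xi eta Z W = vec (dim_vec W) (\<lambda>I.
     cnj xi * cnj (W $ I) + 1/2 * (\<Sum>A<4. \<Sum>B<4. eta A B I * cnj (Z $$ (A, B))))"

definition I1 :: "complex mat \<Rightarrow> complex vec \<Rightarrow> complex" where
  "I1 Z W = 1/2 * (\<Sum>A<4. \<Sum>B<4. Z $$ (A, B) * cnj (Z $$ (A, B)))
     - (\<Sum>I<dim_vec W. W $ I * cnj (W $ I))"

definition I2 :: "complex mat \<Rightarrow> complex vec \<Rightarrow> complex" where
  "I2 Z W = 1/4 * (\<Sum>A<4. \<Sum>B<4. \<Sum>C<4. \<Sum>D<4. eps [A, B, C, D] * Z $$ (A, B) * Z $$ (C, D))
     - (\<Sum>I<dim_vec W. cnj (W $ I) * cnj (W $ I))"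

definition S4 :: "complex mat \<Rightarrow> complex vec \<Rightarrow> complex" where
  "S4 Z W = csqrt ((I1 Z W)\<^sup>2 - of_real ((cmod (I2 Z W))\<^sup>2))"

subsection \<open>N = 5\<close>

definition dZ5 :: "complex vec \<Rightarrow> complex mat \<Rightarrow> complex mat" where
  "dZ5 xi Z = mat 5 5 (\<lambda>(A, B).
     1/2 * (\<Sum>C<5. \<Sum>P<5. \<Sum>Q<5. xi $ C * eps [C, A, B, P, Q] * cnj (Z $$ (P, Q))))"

definition S5 :: "complex mat \<Rightarrow> complex" where
  "S5 Z = 1/2 * csqrt (4 * mat_trace (Amat Z * Amat Z) - (mat_trace (Amat Z))\<^sup>2)"

subsection \<open>N = 6\<close>

definition dZ6 :: "complex mat \<Rightarrow> complex mat \<Rightarrow> complex \<Rightarrow> complex mat" where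
  "dZ6 xi Z X = mat 6 6 (\<lambda>(A, B).
     1/4 * (\<Sum>C<6. \<Sum>D<6. \<Sum>E<6. \<Sum>F<6.
        eps [A, B, C, D, E, F] * cnj (xi $$ (C, D)) * cnj (Z $$ (E, F)))
     + xi $$ (A, B) * cnj X)"

definition dX6 :: "complex mat \<Rightarrow> complex mat \<Rightarrow> complex" where
  "dX6 xi Z = 1/2 * (\<Sum>A<6. \<Sum>B<6. xi $$ (A, B) * cnj (Z $$ (A, B)))"

definition S6 :: "complex mat \<Rightarrow> complex \<Rightarrow> complex" where
  "S6 Z X = 1/2 * csqrt (4 * mat_trace (Amat Z * Amat Z) - (mat_trace (Amat Z))\<^sup>2
     + 32 * of_real (Re (X * Pf Z)) + 4 * mat_trace (Amat Z) * X * cnj X + 4 * X\<^sup>2 * (cnj X)\<^sup>2)"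

subsection \<open>N = 8\<close>

(* Antisymmetry under the three adjacent transpositions is total antisymmetry. *)
definition params8 :: "(nat \<Rightarrow> nat \<Rightarrow> nat \<Rightarrow> nat \<Rightarrow> complex) \<Rightarrow> bool" where
  "params8 xi \<longleftrightarrow> (\<forall>A<8. \<forall>B<8. \<forall>C<8. \<forall>D<8.
     xi B A C D = - xi A B C D \<and> xi A C B D = - xi A B C D \<and> xi A B D C = - xi A B C D \<and>
     xi A B C D = 1/24 * (\<Sum>E<8. \<Sum>F<8. \<Sum>G<8. \<Sum>H<8.
        eps [A, B, C, D, E, F, G, H] * cnj (xi E F G H)))"

definition dZ8 :: "(nat \<Rightarrow> nat \<Rightarrow> nat \<Rightarrow> nat \<Rightarrow> complex) \<Rightarrow> complex mat \<Rightarrow> complex mat" where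
  "dZ8 xi Z = mat 8 8 (\<lambda>(A, B). 1/2 * (\<Sum>C<8. \<Sum>D<8. xi A B C D * cnj (Z $$ (C, D))))"

definition S8 :: "complex mat \<Rightarrow> complex" where
  "S8 Z = 1/2 * csqrt (4 * mat_trace (Amat Z * Amat Z) - (mat_trace (Amat Z))\<^sup>2
     + 32 * of_real (Re (Pf Z)))"

end

theory Submission
  imports Defs
begin

text \<open>
  A matrix with a single nonzero skew-eigenvalue \<open>z1\<close> has the form
  \<open>Z = z1 (a b\<^sup>T - b a\<^sup>T)\<close> with \<open>a\<close>, \<open>b\<close> orthonormal, so its entries satisfy the
  Pluecker relations.  Hence every totally antisymmetric contraction of two copies of \<open>Z\<close> (or of
  its conjugate) vanishes; this kills the terms of first order in \<open>\<delta>V\<close>, the invariant \<open>I2\<close> and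
  the Pfaffian.  What remains of \<open>S\<close> and \<open>V\<close> are norms and traces of a rank two matrix.
\<close>

section \<open>Antisymmetric contractions and the Pfaffian\<close>

text \<open>Exchanging two entries composes the permutation given by the list with
  \<open>transpose i j\<close> on the right, which flips its sign. If the list is not an arrangement
  of its own index range, neither is the exchanged one, and both values are 0.\<close>

lemma eps_swap:
  assumes i: "i < length xs" and j: "j < length xs" and "i \<noteq> j"
  shows "eps (xs[i := xs ! j, j := xs ! i]) = - eps xs"
proof (cases "distinct xs \<and> set xs = {0..<length xs}")
  case False
  then show ?thesis
    using i j by (auto simp: eps_def)
next
  case True
  define f where "f = (\<lambda>k. if k < length xs then xs ! k else k)"
  have "bij_betw ((!) xs) {0..<length xs} {0..<length xs}"
    by (rule bij_betw_nth) (simp_all add: True atLeast0LessThan)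
  moreover have "bij_betw f {0..<length xs} {0..<length xs}
      \<longleftrightarrow> bij_betw ((!) xs) {0..<length xs} {0..<length xs}"
    by (rule bij_betw_cong) (simp add: f_def)
  ultimately have "bij_betw f {0..<length xs} {0..<length xs}"
    by blast
  then have "f permutes {0..<length xs}"
    by (rule bij_imp_permutes) (auto simp: f_def)
  then have perm: "permutation f"
    using permutation_permutes by blast
  have "(\<lambda>k. if k < length xs then xs[i := xs ! j, j := xs ! i] ! k else k) = f \<circ> transpose i j"
    using i j by (auto simp: fun_eq_iff f_def transpose_def nth_list_update)
  moreover have "sign (f \<circ> transpose i j) = - sign f"
    using perm \<open>i \<noteq> j\<close> by (simp add: sign_compose permutation_swap_id sign_swap_id)
  ultimately show ?thesis
    using True i j by (simp add: eps_def f_def)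
qed

lemma eps_upt: "eps [0..<n] = 1"
proof -
  have "(\<lambda>i. if i < n then [0..<n] ! i else i) = id"
    by (auto simp: fun_eq_iff)
  then show ?thesis
    by (simp add: eps_def)
qed

text \<open>
  The Pluecker relation makes the three pairings of the indices of \<open>T\<close> add up to zero, while
  antisymmetry of \<open>T\<close> makes them equal.
\<close>
lemma antisym_contract_pluecker:
  fixes T :: "nat \<Rightarrow> nat \<Rightarrow> nat \<Rightarrow> nat \<Rightarrow> complex"
  assumes T1: "\<And>A B C D. A < n \<Longrightarrow> B < n \<Longrightarrow> C < n \<Longrightarrow> D < n \<Longrightarrow> T A C B D = - T A B C D"
    and T2: "\<And>A B C D. A < n \<Longrightarrow> B < n \<Longrightarrow> C < n \<Longrightarrow> D < n \<Longrightarrow> T A B D C = - T A B C D"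
    and pl: "\<And>A B C D. A < n \<Longrightarrow> B < n \<Longrightarrow> C < n \<Longrightarrow> D < n \<Longrightarrow>
      M A B * M C D - M A C * M B D + M A D * M B C = 0"
  shows "(\<Sum>A<n. \<Sum>B<n. \<Sum>C<n. \<Sum>D<n. T A B C D * M A B * M C D) = 0" (is "?S = 0")
proof -
  have "(\<Sum>B<n. \<Sum>C<n. \<Sum>D<n. T A B C D * M A C * M B D)
      = - (\<Sum>B<n. \<Sum>C<n. \<Sum>D<n. T A B C D * M A B * M C D)" if "A < n" for A
  proof -
    \<comment> \<open>Exchanging the names of \<open>B\<close> and \<open>C\<close> restores the
      pairing of \<open>?S\<close>; the exchange is then paid for by the sign of
      \<open>T\<close>.\<close>
    have "(\<Sum>B<n. \<Sum>C<n. \<Sum>D<n. T A B C D * M A C * M B D)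
        = (\<Sum>B<n. \<Sum>C<n. \<Sum>D<n. T A C B D * M A B * M C D)"
      by (rule sum.swap)
    also have "\<dots> = (\<Sum>B<n. \<Sum>C<n. \<Sum>D<n. - (T A B C D * M A B * M C D))"
      using T1[OF that] by (intro sum.cong refl) (metis lessThan_iff mult_minus_left)
    finally show ?thesis
      by (simp add: sum_negf)
  qed
  then have e1: "(\<Sum>A<n. \<Sum>B<n. \<Sum>C<n. \<Sum>D<n. T A B C D * M A C * M B D) = - ?S"
    by (simp add: sum_negf)
  have "(\<Sum>B<n. \<Sum>C<n. \<Sum>D<n. T A B C D * M A D * M B C)
      = (\<Sum>B<n. \<Sum>C<n. \<Sum>D<n. T A B C D * M A B * M C D)" if "A < n" for A
  proof -
    \<comment> \<open>Here the three inner indices are rotated cyclically. This is an even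
      permutation, so \<open>T\<close> contributes no sign.\<close>
    have "(\<Sum>B<n. \<Sum>C<n. \<Sum>D<n. T A B C D * M A D * M B C)
        = (\<Sum>B<n. \<Sum>D<n. \<Sum>C<n. T A B C D * M A D * M B C)"
      by (rule sum.cong[OF refl], rule sum.swap)
    also have "\<dots> = (\<Sum>D<n. \<Sum>B<n. \<Sum>C<n. T A B C D * M A D * M B C)"
      by (rule sum.swap)
    also have "\<dots> = (\<Sum>B<n. \<Sum>C<n. \<Sum>D<n. T A B C D * M A B * M C D)"
    proof (intro sum.cong refl)
      fix B C D assume "B \<in> {..<n}" "C \<in> {..<n}" "D \<in> {..<n}"
      then have "T A C D B = T A B C D"
        using T1[of A B C D] T2[of A C B D] that by simp
      then show "T A C D B * M A B * M C D = T A B C D * M A B * M C D"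
        by simp
    qed
    finally show ?thesis .
  qed
  then have e2: "(\<Sum>A<n. \<Sum>B<n. \<Sum>C<n. \<Sum>D<n. T A B C D * M A D * M B C) = ?S"
    by simp
  have "3 * ?S = ?S - (\<Sum>A<n. \<Sum>B<n. \<Sum>C<n. \<Sum>D<n. T A B C D * M A C * M B D)
      + (\<Sum>A<n. \<Sum>B<n. \<Sum>C<n. \<Sum>D<n. T A B C D * M A D * M B C)"
    unfolding e1 e2 by simp
  also have "\<dots> = (\<Sum>A<n. \<Sum>B<n. \<Sum>C<n. \<Sum>D<n.
      T A B C D * (M A B * M C D - M A C * M B D + M A D * M B C))"
    by (simp add: sum.distrib sum_subtractf algebra_simps)
  also have "\<dots> = 0"
    by (simp add: pl)
  finally show ?thesis
    by simp
qed

text \<open>The same averaging over three pairings, now inside the sum over permutations: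
  transposing two of the first four positions changes how the first two factors are paired and flips
  the sign. The bound \<open>2 \<le> m\<close> provides these two factors; a nonzero antisymmetric 2
  x 2 matrix shows that the claim fails for \<open>m = 1\<close>.\<close>

lemma Pf_pluecker:
  assumes dim: "dim_row M = 2 * m" and "2 \<le> m"
    and pl: "\<And>A B C D. A < 2 * m \<Longrightarrow> B < 2 * m \<Longrightarrow> C < 2 * m \<Longrightarrow> D < 2 * m \<Longrightarrow>
      M $$ (A, B) * M $$ (C, D) - M $$ (A, C) * M $$ (B, D) + M $$ (A, D) * M $$ (B, C) = 0"
  shows "Pf M = 0"
proof -
  define P where "P = {p. p permutes {0..<2 * m}}"
  \<comment> \<open>\<open>R\<close> collects the factors at positions 4 and above, which no
    transposition of positions below 4 can reach.\<close>
  define R where "R = (\<lambda>p::nat \<Rightarrow> nat. \<Prod>i\<in>{2..<m}. M $$ (p (2 * i), p (2 * i + 1)))"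
  define s where "s = (\<lambda>p::nat \<Rightarrow> nat. (of_int (sign p) :: complex))"
  define S where "S = (\<Sum>p\<in>P. s p * (M $$ (p 0, p 1) * M $$ (p 2, p 3) * R p))"
  have split: "(\<Prod>i<m. M $$ (p (2 * i), p (2 * i + 1))) = M $$ (p 0, p 1) * M $$ (p 2, p 3) * R p"
    for p
  proof -
    have "{..<m} = insert 0 (insert 1 {2..<m})"
      using \<open>2 \<le> m\<close> by auto
    then show ?thesis
      by (simp add: R_def numeral_eq_Suc mult.assoc)
  qed
  have s_comp: "s (p \<circ> transpose a b) = - s p" if "p \<in> P" "a \<noteq> b" for p a b
  proof -
    have "permutation p"
      using that permutation_permutes by (auto simp: P_def)
    then show ?thesis
      using that by (simp add: s_def sign_compose permutation_swap_id sign_swap_id)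
  qed
  have comp_P: "p \<circ> transpose a b \<in> P" if "p \<in> P" "a < 2 * m" "b < 2 * m" for p a b
    using that by (auto simp: P_def intro!: permutes_compose permutes_swap_id)
  have R_comp: "R (p \<circ> transpose a b) = R p" if "a < 4" "b < 4" for p a b
    unfolding R_def using that by (intro prod.cong refl) (auto simp: transpose_def)
  have reindex: "(\<Sum>p\<in>P. g (p \<circ> transpose a b)) = sum g P"
    if "a < 2 * m" "b < 2 * m" for g :: "(nat \<Rightarrow> nat) \<Rightarrow> complex" and a b
    by (rule sum.reindex_bij_witness[where i = "\<lambda>p. p \<circ> transpose a b" and j = "\<lambda>p. p \<circ> transpose a b"])
      (use that comp_P in \<open>auto simp: comp_assoc\<close>)
  have swap: "(\<Sum>p\<in>P. s p * (f (p \<circ> transpose a b) * R p)) = - (\<Sum>p\<in>P. s p * (f p * R p))"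
    if "a < 4" "b < 4" "a \<noteq> b" for f :: "(nat \<Rightarrow> nat) \<Rightarrow> complex" and a b
  proof -
    have "(\<Sum>p\<in>P. s p * (f (p \<circ> transpose a b) * R p))
        = (\<Sum>p\<in>P. - (s (p \<circ> transpose a b) * (f (p \<circ> transpose a b) * R (p \<circ> transpose a b))))"
      using that by (intro sum.cong refl) (simp add: s_comp R_comp)
    also have "\<dots> = - (\<Sum>p\<in>P. s p * (f p * R p))"
      using that \<open>2 \<le> m\<close> reindex[of a b "\<lambda>p. s p * (f p * R p)"] by (simp add: sum_negf)
    finally show ?thesis .
  qed
  \<comment> \<open>Transposing 1 and 2 turns the pairing 01|23 into 02|13; transposing 2 and 3 then
    turns this into 03|12. The signs are therefore -1 and +1.\<close>
  have e1: "(\<Sum>p\<in>P. s p * (M $$ (p 0, p 2) * M $$ (p 1, p 3) * R p)) = - S"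
    using swap[of 1 2 "\<lambda>p. M $$ (p 0, p 1) * M $$ (p 2, p 3)"]
    by (simp add: S_def transpose_def)
  have e2: "(\<Sum>p\<in>P. s p * (M $$ (p 0, p 3) * M $$ (p 1, p 2) * R p)) = S"
    using swap[of 2 3 "\<lambda>p. M $$ (p 0, p 2) * M $$ (p 1, p 3)"] e1
    by (simp add: transpose_def)
  have "3 * S = S - (\<Sum>p\<in>P. s p * (M $$ (p 0, p 2) * M $$ (p 1, p 3) * R p))
      + (\<Sum>p\<in>P. s p * (M $$ (p 0, p 3) * M $$ (p 1, p 2) * R p))"
    unfolding e1 e2 by simp
  also have "\<dots> = (\<Sum>p\<in>P. s p * R p * (M $$ (p 0, p 1) * M $$ (p 2, p 3)
      - M $$ (p 0, p 2) * M $$ (p 1, p 3) + M $$ (p 0, p 3) * M $$ (p 1, p 2)))"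
    unfolding S_def by (simp add: sum.distrib sum_subtractf algebra_simps)
  also have "\<dots> = 0"
  proof (intro sum.neutral ballI)
    fix p assume "p \<in> P"
    then have "p i < 2 * m" if "i < 4" for i
      using that \<open>2 \<le> m\<close> permutes_in_image[of p "{0..<2 * m}" i] by (simp add: P_def)
    then show "s p * R p * (M $$ (p 0, p 1) * M $$ (p 2, p 3)
      - M $$ (p 0, p 2) * M $$ (p 1, p 3) + M $$ (p 0, p 3) * M $$ (p 1, p 2)) = 0"
      by (simp add: pl)
  qed
  finally have "S = 0"
    by simp
  moreover have "Pf M = S / (2 ^ m * fact m)"
    unfolding Pf_def S_def P_def s_def split[symmetric] by (simp add: dim)
  ultimately show ?thesis
    by simp
qed

section \<open>The rank two form of the charge matrix\<close>

text \<open>Inverting the normal form gives \<open>Z = v * normal_form N zs * c\<close>, where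
  \<open>v\<close> is the adjoint of \<open>u\<close> and \<open>c\<close> its entrywise conjugate.
  Only the block at position \<open>k\<close> survives, so \<open>a\<close> and \<open>b\<close> are
  the conjugated rows \<open>2 * k\<close> and \<open>2 * k + 1\<close> of \<open>u\<close>,
  orthonormal because \<open>u\<close> is unitary.\<close>

lemma single_skew_eigenvalueE:
  assumes "single_skew_eigenvalue N Z z1" and Z: "Z \<in> carrier_mat N N"
  obtains a b :: "nat \<Rightarrow> complex"
  where "\<And>A B. A < N \<Longrightarrow> B < N \<Longrightarrow> Z $$ (A, B) = z1 * (a A * b B - b A * a B)"
    and "(\<Sum>A<N. a A * cnj (a A)) = 1" "(\<Sum>A<N. b A * cnj (b A)) = 1"
    and "(\<Sum>A<N. a A * cnj (b A)) = 0" "(\<Sum>A<N. b A * cnj (a A)) = 0"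
proof -
  from assms obtain zs k u where k: "k < N div 2" and zk: "zs ! k = z1"
    and z0: "\<And>a. a < N div 2 \<Longrightarrow> a \<noteq> k \<Longrightarrow> zs ! a = 0"
    and U: "unitary_mat N u" and NF: "u * Z * transpose_mat u = normal_form N zs"
    unfolding single_skew_eigenvalue_def skew_eigenvalues_def by blast
  define c where "c = cnj_mat u"
  define v where "v = transpose_mat c"
  have u: "u \<in> carrier_mat N N" and uv: "u * v = 1\<^sub>m N" and vu: "v * u = 1\<^sub>m N"
    using U by (auto simp: unitary_mat_def v_def c_def)
  have c: "c \<in> carrier_mat N N"
    using u by (simp add: c_def cnj_mat_def)
  have v: "v \<in> carrier_mat N N"
    using c by (simp add: v_def)
  have tu: "transpose_mat u \<in> carrier_mat N N"
    using u by simp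
  \<comment> \<open>On the right, \<open>Z\<close> is multiplied by the transpose of
    \<open>u\<close>, not by its adjoint; transposing \<open>v * u = 1\<^sub>m N\<close> shows that
    \<open>c\<close> cancels it.\<close>
  have "transpose_mat (v * u) = transpose_mat u * transpose_mat v"
    using v u by (rule transpose_mult)
  then have uc: "transpose_mat u * c = 1\<^sub>m N"
    unfolding vu by (simp add: v_def)
  have nf: "normal_form N zs \<in> carrier_mat N N"
    by (simp add: normal_form_def)
  have "v * normal_form N zs * c = v * (u * Z * transpose_mat u) * c"
    by (simp add: NF)
  also have "\<dots> = (v * u) * Z * (transpose_mat u * c)"
  proof -
    have uZ: "u * Z \<in> carrier_mat N N"
      using u Z by simp
    have "v * (u * Z * transpose_mat u) = v * u * Z * transpose_mat u"
      using assoc_mult_mat[OF v uZ tu] assoc_mult_mat[OF v u Z] by simp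
    moreover have "v * u * Z \<in> carrier_mat N N"
      using u v Z by simp
    ultimately show ?thesis
      using assoc_mult_mat[OF _ tu c] by simp
  qed
  also have "\<dots> = Z"
    using Z by (simp add: vu uc)
  finally have Zeq: "Z = v * normal_form N zs * c" ..
  define a where "a = (\<lambda>A. cnj (u $$ (2 * k, A)))"
  define b where "b = (\<lambda>A. cnj (u $$ (2 * k + 1, A)))"
  have k1: "2 * k + 1 < N"
    using k by simp
  have nf_entry: "normal_form N zs $$ (i, j) = (if i = 2 * k \<and> j = 2 * k + 1 then z1 else 0)
      - (if i = 2 * k + 1 \<and> j = 2 * k then z1 else 0)" if "i < N" "j < N" for i j
  proof -
    \<comment> \<open>For odd \<open>N\<close> the index \<open>N - 1\<close> is even and its half
      lies outside the list \<open>zs\<close>. The bound \<open>j < N\<close> on the partner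
      \<open>j = i + 1\<close> excludes this index.\<close>
    have 1: "zs ! (i div 2) = (if i = 2 * k then z1 else 0)" if "even i" "j = i + 1"
    proof (cases "i = 2 * k")
      case False
      then have "i div 2 \<noteq> k" "i div 2 < N div 2"
        using that \<open>j < N\<close> by auto
      then show ?thesis
        using False z0 by simp
    qed (simp add: zk)
    have 2: "zs ! (j div 2) = (if j = 2 * k then z1 else 0)" if "even j" "i = j + 1"
    proof (cases "j = 2 * k")
      case False
      then have "j div 2 \<noteq> k" "j div 2 < N div 2"
        using that \<open>i < N\<close> by auto
      then show ?thesis
        using False z0 by simp
    qed (simp add: zk)
    show ?thesis
      using that 1 2 by (auto simp: normal_form_def)
  qed
  have "Z $$ (A, B) = z1 * (a A * b B - b A * a B)" if "A < N" "B < N" for A B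
  proof -
    have "Z $$ (A, B) = (\<Sum>j<N. (\<Sum>i<N. v $$ (A, i) * normal_form N zs $$ (i, j)) * c $$ (j, B))"
      using that v nf c
      by (subst Zeq) (simp add: scalar_prod_def atLeast0LessThan del: assoc_mult_mat)
    also have "\<dots> = (\<Sum>j<N. ((if j = 2 * k + 1 then z1 * v $$ (A, 2 * k) else 0)
        - (if j = 2 * k then z1 * v $$ (A, 2 * k + 1) else 0)) * c $$ (j, B))"
    proof (intro sum.cong refl arg_cong2[of _ _ _ _ "(*)"])
      fix j assume "j \<in> {..<N}"
      then have "(\<Sum>i<N. v $$ (A, i) * normal_form N zs $$ (i, j))
        = (\<Sum>i<N. (if i = 2 * k then (if j = 2 * k + 1 then z1 * v $$ (A, i) else 0) else 0)
           - (if i = 2 * k + 1 then (if j = 2 * k then z1 * v $$ (A, i) else 0) else 0))"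
        by (intro sum.cong refl) (auto simp: nf_entry)
      also have "\<dots> = (if j = 2 * k + 1 then z1 * v $$ (A, 2 * k) else 0)
        - (if j = 2 * k then z1 * v $$ (A, 2 * k + 1) else 0)"
        using k1 by (simp add: sum_subtractf)
      finally show "(\<Sum>i<N. v $$ (A, i) * normal_form N zs $$ (i, j)) =
        (if j = 2 * k + 1 then z1 * v $$ (A, 2 * k) else 0)
        - (if j = 2 * k then z1 * v $$ (A, 2 * k + 1) else 0)" .
    qed
    also have "\<dots> = z1 * v $$ (A, 2 * k) * c $$ (2 * k + 1, B) - z1 * v $$ (A, 2 * k + 1) * c $$ (2 * k, B)"
      using k1 by (simp add: left_diff_distrib sum_subtractf if_distrib[of "\<lambda>x. x * _"] cong: if_cong)
    also have "\<dots> = z1 * (a A * b B - b A * a B)"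
      using that k1 u by (simp add: v_def c_def cnj_mat_def a_def b_def algebra_simps)
    finally show ?thesis .
  qed
  moreover have ortho: "(\<Sum>A<N. u $$ (i, A) * cnj (u $$ (j, A))) = (if i = j then 1 else 0)"
    if "i < N" "j < N" for i j
  proof -
    have "(\<Sum>A<N. u $$ (i, A) * cnj (u $$ (j, A))) = (u * v) $$ (i, j)"
      using that u v by (simp add: scalar_prod_def atLeast0LessThan v_def c_def cnj_mat_def)
    then show ?thesis
      using that by (simp add: uv)
  qed
  ultimately show ?thesis
    using k1 ortho[of "2 * k" "2 * k"] ortho[of "2 * k + 1" "2 * k + 1"]
      ortho[of "2 * k" "2 * k + 1"] ortho[of "2 * k + 1" "2 * k"]
    by (intro that[of a b]) (auto simp: a_def b_def mult.commute)
qed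

text \<open>Up to the factor \<open>z1\<close> the entries of \<open>Z\<close> are the 2 x 2 minors
  of the matrix with columns \<open>a\<close> and \<open>b\<close>, and for such minors the
  three-term relation is a polynomial identity.\<close>

lemma single_skew_eigenvalue_pluecker:
  assumes "single_skew_eigenvalue N Z z1" "Z \<in> carrier_mat N N"
    and "A < N" "B < N" "C < N" "D < N"
  shows "Z $$ (A, B) * Z $$ (C, D) - Z $$ (A, C) * Z $$ (B, D) + Z $$ (A, D) * Z $$ (B, C) = 0"
proof -
  obtain a b where ab: "\<And>A B. A < N \<Longrightarrow> B < N \<Longrightarrow> Z $$ (A, B) = z1 * (a A * b B - b A * a B)"
    using single_skew_eigenvalueE[OF assms(1,2)] by metis
  then show ?thesis
    using assms(3-) by (simp add: ab algebra_simps)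
qed

text \<open>Conjugation preserves the Pluecker relations, which gives the second identity with the
  same \<open>T\<close>. The first identity serves \<open>I2\<close>, the second the first-order
  terms of the potential.\<close>

lemma antisym_contract_single_skew:
  assumes "single_skew_eigenvalue N Z z1" "Z \<in> carrier_mat N N"
    and "\<And>A B C D. A < N \<Longrightarrow> B < N \<Longrightarrow> C < N \<Longrightarrow> D < N \<Longrightarrow> T A C B D = - T A B C D"
    and "\<And>A B C D. A < N \<Longrightarrow> B < N \<Longrightarrow> C < N \<Longrightarrow> D < N \<Longrightarrow> T A B D C = - T A B C D"
  shows "(\<Sum>A<N. \<Sum>B<N. \<Sum>C<N. \<Sum>D<N. T A B C D * Z $$ (A, B) * Z $$ (C, D)) = 0"
    and "(\<Sum>A<N. \<Sum>B<N. \<Sum>C<N. \<Sum>D<N. T A B C D * cnj (Z $$ (A, B)) * cnj (Z $$ (C, D))) = 0"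
proof -
  note pl = single_skew_eigenvalue_pluecker[OF assms(1,2)]
  show "(\<Sum>A<N. \<Sum>B<N. \<Sum>C<N. \<Sum>D<N. T A B C D * Z $$ (A, B) * Z $$ (C, D)) = 0"
    by (rule antisym_contract_pluecker[where M = "\<lambda>A B. Z $$ (A, B)"])
      (rule assms(3,4) pl; assumption)+
  have pl': "cnj (Z $$ (A, B)) * cnj (Z $$ (C, D)) - cnj (Z $$ (A, C)) * cnj (Z $$ (B, D))
      + cnj (Z $$ (A, D)) * cnj (Z $$ (B, C)) = 0" if "A < N" "B < N" "C < N" "D < N" for A B C D
    using arg_cong[OF pl[OF that], of cnj] by simp
  show "(\<Sum>A<N. \<Sum>B<N. \<Sum>C<N. \<Sum>D<N. T A B C D * cnj (Z $$ (A, B)) * cnj (Z $$ (C, D))) = 0"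
    by (rule antisym_contract_pluecker[where M = "\<lambda>A B. cnj (Z $$ (A, B))"])
      (rule assms(3,4) pl'; assumption)+
qed

section \<open>Potential and traces at the attractor point\<close>

text \<open>The double sum splits into products of inner products of \<open>a\<close> and
  \<open>b\<close>. Orthonormality kills the mixed ones and leaves twice the squared modulus of
  \<open>z1\<close>, once for each order of the index pair.\<close>

lemma V_grav_single_skew:
  assumes "single_skew_eigenvalue N Z z1" and Z: "Z \<in> carrier_mat N N"
  shows "V_grav Z = of_real ((cmod z1)\<^sup>2)"
proof -
  obtain a b where ab: "\<And>A B. A < N \<Longrightarrow> B < N \<Longrightarrow> Z $$ (A, B) = z1 * (a A * b B - b A * a B)"
    and n: "(\<Sum>A<N. a A * cnj (a A)) = 1" "(\<Sum>A<N. b A * cnj (b A)) = 1"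
      "(\<Sum>A<N. a A * cnj (b A)) = 0" "(\<Sum>A<N. b A * cnj (a A)) = 0"
    using single_skew_eigenvalueE[OF assms] by blast
  have "(\<Sum>B<N. Z $$ (A, B) * cnj (Z $$ (A, B)))
      = z1 * cnj z1 * (a A * cnj (a A) + b A * cnj (b A))" if "A < N" for A
  proof -
    have "(\<Sum>B<N. Z $$ (A, B) * cnj (Z $$ (A, B)))
        = z1 * cnj z1 * (a A * cnj (a A) * (\<Sum>B<N. b B * cnj (b B))
          - a A * cnj (b A) * (\<Sum>B<N. b B * cnj (a B))
          - b A * cnj (a A) * (\<Sum>B<N. a B * cnj (b B))
          + b A * cnj (b A) * (\<Sum>B<N. a B * cnj (a B)))"
      unfolding sum_distrib_left sum_subtractf[symmetric] sum.distrib[symmetric]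
      using that by (intro sum.cong refl) (simp add: ab algebra_simps)
    then show ?thesis
      by (simp add: n)
  qed
  then have "V_grav Z = 1/2 * (\<Sum>A<N. z1 * cnj z1 * (a A * cnj (a A) + b A * cnj (b A)))"
    using Z by (simp add: V_grav_def)
  also have "\<dots> = z1 * cnj z1"
    by (simp add: sum_distrib_left[symmetric] sum.distrib n)
  finally show ?thesis
    by (simp only: complex_norm_square)
qed

text \<open>\<open>Amat Z\<close> is \<open>- r\<close> times the orthogonal projection onto the
  plane spanned by \<open>a\<close> and \<open>b\<close>, with \<open>r\<close> the squared modulus
  of \<open>z1\<close>. The minus sign arises because \<open>cnj_mat Z\<close> is minus the adjoint
  of the antisymmetric \<open>Z\<close>.\<close>

lemma mat_trace_Amat_single_skew:
  assumes "single_skew_eigenvalue N Z z1" and Z: "Z \<in> carrier_mat N N"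
  shows "mat_trace (Amat Z) = - 2 * of_real ((cmod z1)\<^sup>2)"
    and "mat_trace (Amat Z * Amat Z) = 2 * (of_real ((cmod z1)\<^sup>2))\<^sup>2"
proof -
  obtain a b where ab: "\<And>A B. A < N \<Longrightarrow> B < N \<Longrightarrow> Z $$ (A, B) = z1 * (a A * b B - b A * a B)"
    and n: "(\<Sum>A<N. a A * cnj (a A)) = 1" "(\<Sum>A<N. b A * cnj (b A)) = 1"
      "(\<Sum>A<N. a A * cnj (b A)) = 0" "(\<Sum>A<N. b A * cnj (a A)) = 0"
    using single_skew_eigenvalueE[OF assms] by blast
  define r where "r = z1 * cnj z1"
  have r: "r = of_real ((cmod z1)\<^sup>2)"
    by (simp only: r_def complex_norm_square)
  have carrier: "Amat Z \<in> carrier_mat N N"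
    using Z by (simp add: Amat_def cnj_mat_def)
  have entry: "Amat Z $$ (A, B) = - r * (a A * cnj (a B) + b A * cnj (b B))"
    if "A < N" "B < N" for A B
  proof -
    have "Amat Z $$ (A, B) = (\<Sum>C<N. Z $$ (A, C) * cnj (Z $$ (C, B)))"
      using that Z by (simp add: Amat_def cnj_mat_def scalar_prod_def atLeast0LessThan)
    also have "\<dots> = r * (a A * cnj (b B) * (\<Sum>C<N. b C * cnj (a C))
          - a A * cnj (a B) * (\<Sum>C<N. b C * cnj (b C))
          - b A * cnj (b B) * (\<Sum>C<N. a C * cnj (a C))
          + b A * cnj (a B) * (\<Sum>C<N. a C * cnj (b C)))"
      unfolding sum_distrib_left sum_subtractf[symmetric] sum.distrib[symmetric]
      using that by (intro sum.cong refl) (simp add: ab r_def algebra_simps)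
    also have "\<dots> = - r * (a A * cnj (a B) + b A * cnj (b B))"
      by (simp add: n algebra_simps)
    finally show ?thesis .
  qed
  have "mat_trace (Amat Z) = (\<Sum>A<N. - r * (a A * cnj (a A) + b A * cnj (b A)))"
    using carrier by (simp add: mat_trace_def entry)
  also have "\<dots> = - 2 * r"
    unfolding sum_distrib_left[symmetric] by (simp add: sum.distrib n)
  finally show "mat_trace (Amat Z) = - 2 * of_real ((cmod z1)\<^sup>2)"
    by (simp add: r)
  have sq: "(\<Sum>B<N. Amat Z $$ (A, B) * Amat Z $$ (B, A))
      = r\<^sup>2 * (a A * cnj (a A) + b A * cnj (b A))" if "A < N" for A
  proof -
    have "(\<Sum>B<N. Amat Z $$ (A, B) * Amat Z $$ (B, A))
        = r\<^sup>2 * (a A * cnj (a A) * (\<Sum>B<N. a B * cnj (a B))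
          + a A * cnj (b A) * (\<Sum>B<N. b B * cnj (a B))
          + b A * cnj (a A) * (\<Sum>B<N. a B * cnj (b B))
          + b A * cnj (b A) * (\<Sum>B<N. b B * cnj (b B)))"
      unfolding sum_distrib_left sum.distrib[symmetric]
      using that by (intro sum.cong refl) (simp add: entry power2_eq_square algebra_simps)
    then show ?thesis
      by (simp add: n)
  qed
  have "mat_trace (Amat Z * Amat Z) = (\<Sum>A<N. \<Sum>B<N. Amat Z $$ (A, B) * Amat Z $$ (B, A))"
    using carrier by (simp add: mat_trace_def scalar_prod_def atLeast0LessThan)
  also have "\<dots> = r\<^sup>2 * (\<Sum>A<N. a A * cnj (a A) + b A * cnj (b A))"
    by (simp add: sq sum_distrib_left)
  also have "\<dots> = 2 * r\<^sup>2"
    by (simp add: sum.distrib n)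
  finally show "mat_trace (Amat Z * Amat Z) = 2 * (of_real ((cmod z1)\<^sup>2))\<^sup>2"
    by (simp add: r)
qed

lemma csqrt_power2_of_real: "0 \<le> x \<Longrightarrow> csqrt ((of_real x)\<^sup>2) = of_real x"
  by (rule csqrt_square) auto

text \<open>With \<open>r\<close> the squared modulus of \<open>z1\<close>, the radicand is 8 r^2 -
  4 r^2 = (2 r)^2, and since \<open>r\<close> is nonnegative the principal root is 2 r. This is the
  part of the radicand common to \<open>S5\<close>, \<open>S6\<close> and \<open>S8\<close>.\<close>

lemma half_csqrt_trace_single_skew:
  assumes "single_skew_eigenvalue N Z z1" and "Z \<in> carrier_mat N N"
  shows "1/2 * csqrt (4 * mat_trace (Amat Z * Amat Z) - (mat_trace (Amat Z))\<^sup>2) = V_grav Z"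
proof -
  have "4 * mat_trace (Amat Z * Amat Z) - (mat_trace (Amat Z))\<^sup>2
      = (of_real (2 * (cmod z1)\<^sup>2))\<^sup>2"
    unfolding mat_trace_Amat_single_skew[OF assms] by (simp add: power_mult_distrib)
  then have "csqrt (4 * mat_trace (Amat Z * Amat Z) - (mat_trace (Amat Z))\<^sup>2)
      = of_real (2 * (cmod z1)\<^sup>2)"
    by (metis csqrt_power2_of_real zero_le_mult_iff zero_le_numeral zero_le_power2)
  then show ?thesis
    by (simp add: V_grav_single_skew[OF assms])
qed

section \<open>Stationarity from a vanishing first-order pairing\<close>

text \<open>The linear coefficient in \<open>t\<close> is the real part of the pairing of
  \<open>D\<close> with \<open>Z\<close>, which vanishes by hypothesis. The exact quadratic form,
  rather than just the derivative, lets matter and singlet terms be added to it.\<close>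

lemma V_grav_add_smult:
  assumes Z: "Z \<in> carrier_mat N N" and D: "D \<in> carrier_mat N N"
    and orth: "(\<Sum>A<N. \<Sum>B<N. D $$ (A, B) * cnj (Z $$ (A, B))) = 0"
  shows "V_grav (Z + of_real t \<cdot>\<^sub>m D) = V_grav Z + of_real (t\<^sup>2) * V_grav D"
proof -
  have orth': "(\<Sum>A<N. \<Sum>B<N. Z $$ (A, B) * cnj (D $$ (A, B))) = 0"
    using arg_cong[OF orth, of cnj] by (simp add: mult.commute)
  have "V_grav (Z + of_real t \<cdot>\<^sub>m D) = 1/2 * (\<Sum>A<N. \<Sum>B<N.
      (Z $$ (A, B) + of_real t * D $$ (A, B)) * cnj (Z $$ (A, B) + of_real t * D $$ (A, B)))"
    using Z D by (simp add: V_grav_def)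
  also have "\<dots> = 1/2 * ((\<Sum>A<N. \<Sum>B<N. Z $$ (A, B) * cnj (Z $$ (A, B)))
      + of_real t * (\<Sum>A<N. \<Sum>B<N. Z $$ (A, B) * cnj (D $$ (A, B)))
      + of_real t * (\<Sum>A<N. \<Sum>B<N. D $$ (A, B) * cnj (Z $$ (A, B)))
      + of_real (t\<^sup>2) * (\<Sum>A<N. \<Sum>B<N. D $$ (A, B) * cnj (D $$ (A, B))))"
    unfolding sum_distrib_left sum.distrib[symmetric]
    by (intro sum.cong refl) (simp add: algebra_simps power2_eq_square)
  also have "\<dots> = V_grav Z + of_real (t\<^sup>2) * V_grav D"
    using Z D by (simp add: orth orth' V_grav_def algebra_simps)
  finally show ?thesis .
qed

lemma has_vector_derivative_quadratic:
  fixes f :: "real \<Rightarrow> complex"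
  assumes "\<And>t. f t = c + of_real (t\<^sup>2) * d"
  shows "(f has_vector_derivative 0) (at 0)"
proof -
  have "((\<lambda>t. t\<^sup>2) has_real_derivative 0) (at (0::real))"
    by (auto intro!: derivative_eq_intros)
  then have "((\<lambda>t::real. c + of_real (t\<^sup>2) * d) has_vector_derivative 0 + of_real 0 * d) (at 0)"
    by (intro has_vector_derivative_add has_vector_derivative_const has_vector_derivative_mult_left
        has_vector_derivative_of_real)
  moreover have "f = (\<lambda>t. c + of_real (t\<^sup>2) * d)"
    using assms by blast
  ultimately show ?thesis
    by simp
qed

lemma V_grav_stationary:
  assumes "Z \<in> carrier_mat N N" "D \<in> carrier_mat N N"
    and "(\<Sum>A<N. \<Sum>B<N. D $$ (A, B) * cnj (Z $$ (A, B))) = 0"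
  shows "((\<lambda>t. V_grav (Z + of_real t \<cdot>\<^sub>m D)) has_vector_derivative 0) (at 0)"
  by (rule has_vector_derivative_quadratic) (rule V_grav_add_smult[OF assms])

text \<open>Around vanishing matter charges the matter term is itself of order
  \<open>t\<^sup>2\<close> for any direction \<open>w\<close>, so only the pairing of
  \<open>D\<close> with \<open>Z\<close> has to be controlled.\<close>

lemma V_matter_stationary:
  assumes "Z \<in> carrier_mat N N" "D \<in> carrier_mat N N"
    and "(\<Sum>A<N. \<Sum>B<N. D $$ (A, B) * cnj (Z $$ (A, B))) = 0"
    and "w \<in> carrier_vec n"
  shows "((\<lambda>t. V_matter (Z + of_real t \<cdot>\<^sub>m D) (0\<^sub>v n + of_real t \<cdot>\<^sub>v w)) has_vector_derivative 0) (at 0)"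
proof (rule has_vector_derivative_quadratic)
  fix t :: real
  show "V_matter (Z + of_real t \<cdot>\<^sub>m D) (0\<^sub>v n + of_real t \<cdot>\<^sub>v w)
      = V_grav Z + of_real (t\<^sup>2) * V_matter D w"
    using assms(4) unfolding V_matter_def V_grav_add_smult[OF assms(1-3)]
    by (simp add: algebra_simps sum_distrib_left power2_eq_square)
qed

lemma V_singlet_stationary:
  assumes "Z \<in> carrier_mat N N" "D \<in> carrier_mat N N"
    and "(\<Sum>A<N. \<Sum>B<N. D $$ (A, B) * cnj (Z $$ (A, B))) = 0"
  shows "((\<lambda>t. V_singlet (Z + of_real t \<cdot>\<^sub>m D) (0 + of_real t * x)) has_vector_derivative 0) (at 0)"
proof (rule has_vector_derivative_quadratic)
  fix t :: real
  show "V_singlet (Z + of_real t \<cdot>\<^sub>m D) (0 + of_real t * x) = V_grav Z + of_real (t\<^sup>2) * V_singlet D x"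
    unfolding V_singlet_def V_grav_add_smult[OF assms(1-3)]
    by (simp add: algebra_simps power2_eq_square)
qed

section \<open>The individual values of N\<close>

lemma V_matter_zero: "V_matter Z (0\<^sub>v n) = V_grav Z"
  by (simp add: V_matter_def)

lemma Zmat3_carrier: "Zmat3 z \<in> carrier_mat 3 3"
  by (simp add: Zmat3_def)

text \<open>Each component of \<open>z\<close> fills two entries of \<open>Zmat3 z\<close>, with
  opposite signs, and the factor 1/2 in the potential compensates for this.\<close>

lemma V_grav_Zmat3: "V_grav (Zmat3 z) = (\<Sum>A<3. z $ A * cnj (z $ A))"
proof -
  \<comment> \<open>All six nonzero values follow from the normalisation by one or two
    exchanges.\<close>
  have e: "eps [0, 1, 2] = 1"
    using eps_upt[of 3] by (simp add: upt_rec numeral_2_eq_2)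
  have e': "eps [1, 0, 2] = -1" "eps [0, 2, 1] = -1" "eps [2, 1, 0] = -1"
    using eps_swap[of 0 "[0, 1, 2]" 1] eps_swap[of 1 "[0, 1, 2]" 2] eps_swap[of 0 "[0, 1, 2]" 2] e
    by simp_all
  have e'': "eps [1, 2, 0] = 1" "eps [2, 0, 1] = 1"
    using eps_swap[of 1 "[1, 0, 2]" 2] eps_swap[of 0 "[0, 2, 1]" 1] e' by simp_all
  have e0: "eps [i, i, j] = 0" "eps [i, j, i] = 0" "eps [j, i, i] = 0" for i j
    by (simp_all add: eps_def)
  have "{..<3} = {0, 1, 2::nat}"
    by auto
  then show ?thesis
    using e e' e'' by (simp add: V_grav_def Zmat3_def e0)
qed

text \<open>At \<open>W = 0\<close> the variation of \<open>z\<close> is zero, so the direction of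
  \<open>Z\<close> is the zero matrix and only the matter charges move.\<close>

lemma stationary3:
  assumes "z \<in> carrier_vec 3" "xi \<in> carrier_mat 3 n"
  shows "((\<lambda>t. V_matter (Zmat3 (z + of_real t \<cdot>\<^sub>v dZ3 xi (0\<^sub>v n))) (0\<^sub>v n + of_real t \<cdot>\<^sub>v dW3 xi z))
    has_vector_derivative 0) (at 0)"
proof -
  have "Zmat3 (z + of_real t \<cdot>\<^sub>v dZ3 xi (0\<^sub>v n)) = Zmat3 z + of_real t \<cdot>\<^sub>m 0\<^sub>m 3 3" for t :: real
    using assms by (intro eq_matI) (auto simp: Zmat3_def dZ3_def)
  moreover have "dW3 xi z \<in> carrier_vec n"
    using assms by (simp add: dW3_def)
  ultimately show ?thesis
    using V_matter_stationary[OF Zmat3_carrier, of "0\<^sub>m 3 3" z "dW3 xi z" n] by simp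
qed

lemma eps4_swap:
  "eps [A, C, B, D] = - eps [A, B, C, D]" "eps [A, B, D, C] = - eps [A, B, C, D]"
  using eps_swap[of 1 "[A, B, C, D]" 2] eps_swap[of 2 "[A, B, C, D]" 3] by simp_all

text \<open>Without matter charges the \<open>eta\<close> terms drop out of \<open>dZ4\<close>, and
  pairing the rest with \<open>Z\<close> contracts epsilon with two copies of the conjugate of
  \<open>Z\<close>.\<close>

lemma stationary4:
  assumes skew: "single_skew_eigenvalue 4 Z z1" and Z: "Z \<in> carrier_mat 4 4"
  shows "((\<lambda>t. V_matter (Z + of_real t \<cdot>\<^sub>m dZ4 xi eta Z (0\<^sub>v n)) (0\<^sub>v n + of_real t \<cdot>\<^sub>v dW4 xi eta Z (0\<^sub>v n)))
    has_vector_derivative 0) (at 0)"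
proof (rule V_matter_stationary[OF Z])
  show "dZ4 xi eta Z (0\<^sub>v n) \<in> carrier_mat 4 4" "dW4 xi eta Z (0\<^sub>v n) \<in> carrier_vec n"
    by (simp_all add: dZ4_def dW4_def)
  have "(\<Sum>A<4. \<Sum>B<4. dZ4 xi eta Z (0\<^sub>v n) $$ (A, B) * cnj (Z $$ (A, B)))
      = 1/2 * xi * (\<Sum>A<4. \<Sum>B<4. \<Sum>C<4. \<Sum>D<4.
          eps [A, B, C, D] * cnj (Z $$ (A, B)) * cnj (Z $$ (C, D)))"
    by (simp add: dZ4_def sum_distrib_left sum_distrib_right mult_ac)
  also have "\<dots> = 0"
    using antisym_contract_single_skew(2)[OF skew Z, of "\<lambda>A B C D. eps [A, B, C, D]", OF eps4_swap] by simp
  finally show "(\<Sum>A<4. \<Sum>B<4. dZ4 xi eta Z (0\<^sub>v n) $$ (A, B) * cnj (Z $$ (A, B))) = 0" .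
qed

text \<open>\<open>I2\<close> is an epsilon contraction of two copies of \<open>Z\<close> and
  vanishes, while \<open>I1\<close> reduces to the potential; \<open>S4\<close> is the root of its
  square.\<close>

lemma S4_single_skew:
  assumes skew: "single_skew_eigenvalue 4 Z z1" and Z: "Z \<in> carrier_mat 4 4"
  shows "S4 Z (0\<^sub>v n) = V_grav Z"
proof -
  have "(\<Sum>A<4. \<Sum>B<4. \<Sum>C<4. \<Sum>D<4. eps [A, B, C, D] * Z $$ (A, B) * Z $$ (C, D)) = 0"
    using antisym_contract_single_skew(1)[OF skew Z, of "\<lambda>A B C D. eps [A, B, C, D]", OF eps4_swap] .
  then have "I2 Z (0\<^sub>v n) = 0"
    by (simp add: I2_def)
  moreover have "I1 Z (0\<^sub>v n) = of_real ((cmod z1)\<^sup>2)"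
    unfolding V_grav_single_skew[OF skew Z, symmetric] using Z by (simp add: I1_def V_grav_def)
  moreover have "csqrt ((of_real ((cmod z1)\<^sup>2))\<^sup>2) = of_real ((cmod z1)\<^sup>2)"
    by (rule csqrt_power2_of_real) simp
  ultimately show ?thesis
    unfolding S4_def V_grav_single_skew[OF skew Z] by (simp only: norm_zero of_real_0 power_zero_numeral diff_zero)
qed

text \<open>Contracting epsilon with \<open>xi\<close> over its first index leaves a four-index
  tensor \<open>T\<close>, still antisymmetric in the remaining indices.\<close>

lemma stationary5:
  assumes skew: "single_skew_eigenvalue 5 Z z1" and Z: "Z \<in> carrier_mat 5 5"
  shows "((\<lambda>t. V_grav (Z + of_real t \<cdot>\<^sub>m dZ5 xi Z)) has_vector_derivative 0) (at 0)"
proof (rule V_grav_stationary[OF Z])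
  show "dZ5 xi Z \<in> carrier_mat 5 5"
    by (simp add: dZ5_def)
  define T where "T = (\<lambda>A B P Q. \<Sum>C<5. xi $ C * eps [C, A, B, P, Q])"
  have T: "T A P B Q = - T A B P Q" "T A B Q P = - T A B P Q" for A B P Q
  proof -
    have "eps [C, A, P, B, Q] = - eps [C, A, B, P, Q]" "eps [C, A, B, Q, P] = - eps [C, A, B, P, Q]" for C
      using eps_swap[of 2 "[C, A, B, P, Q]" 3] eps_swap[of 3 "[C, A, B, P, Q]" 4] by simp_all
    then show "T A P B Q = - T A B P Q" "T A B Q P = - T A B P Q"
      unfolding T_def by (simp_all only: mult_minus_right sum_negf)
  qed
  have "dZ5 xi Z $$ (A, B) * cnj (Z $$ (A, B))
      = 1/2 * (\<Sum>P<5. \<Sum>Q<5. T A B P Q * cnj (Z $$ (A, B)) * cnj (Z $$ (P, Q)))"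
    if "A < 5" "B < 5" for A B
  proof -
    \<comment> \<open>The sum over \<open>C\<close> is moved innermost, where it forms
      \<open>T\<close>.\<close>
    have "(\<Sum>C<5. \<Sum>P<5. \<Sum>Q<5. xi $ C * eps [C, A, B, P, Q] * cnj (Z $$ (P, Q)))
        = (\<Sum>P<5. \<Sum>Q<5. \<Sum>C<5. xi $ C * eps [C, A, B, P, Q] * cnj (Z $$ (P, Q)))"
      by (rule trans[OF sum.swap], rule sum.cong[OF refl], rule sum.swap)
    then have "dZ5 xi Z $$ (A, B) = 1/2 * (\<Sum>P<5. \<Sum>Q<5. T A B P Q * cnj (Z $$ (P, Q)))"
      using that by (simp add: dZ5_def T_def sum_distrib_right)
    then show ?thesis
      by (simp add: sum_distrib_left sum_distrib_right mult_ac)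
  qed
  then have "(\<Sum>A<5. \<Sum>B<5. dZ5 xi Z $$ (A, B) * cnj (Z $$ (A, B)))
      = 1/2 * (\<Sum>A<5. \<Sum>B<5. \<Sum>P<5. \<Sum>Q<5. T A B P Q * cnj (Z $$ (A, B)) * cnj (Z $$ (P, Q)))"
    unfolding sum_distrib_left by simp
  also have "\<dots> = 0"
    using antisym_contract_single_skew(2)[OF skew Z, of T, OF T] by simp
  finally show "(\<Sum>A<5. \<Sum>B<5. dZ5 xi Z $$ (A, B) * cnj (Z $$ (A, B))) = 0" .
qed

text \<open>At \<open>X = 0\<close> only the epsilon term of \<open>dZ6\<close> is left. Summing it
  over the index pair of \<open>xi\<close> gives the antisymmetric tensor \<open>T\<close>, and
  \<open>X\<close> itself moves only at first order, which its quadratic potential does not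
  see.\<close>

lemma stationary6:
  assumes skew: "single_skew_eigenvalue 6 Z z1" and Z: "Z \<in> carrier_mat 6 6"
  shows "((\<lambda>t. V_singlet (Z + of_real t \<cdot>\<^sub>m dZ6 xi Z 0) (0 + of_real t * dX6 xi Z))
    has_vector_derivative 0) (at 0)"
proof (rule V_singlet_stationary[OF Z])
  show "dZ6 xi Z 0 \<in> carrier_mat 6 6"
    by (simp add: dZ6_def)
  define T where "T = (\<lambda>A B E F. \<Sum>C<6. \<Sum>D<6. eps [A, B, C, D, E, F] * cnj (xi $$ (C, D)))"
  have T: "T A E B F = - T A B E F" "T A B F E = - T A B E F" for A B E F
  proof -
    \<comment> \<open>Neighbouring indices \<open>B\<close> and \<open>E\<close> of \<open>T\<close>
      sit at the distant positions 1 and 4 of epsilon, so \<open>eps_swap\<close> is applied to a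
      pair that is not adjacent.\<close>
    have "eps [A, E, C, D, B, F] = - eps [A, B, C, D, E, F]"
      "eps [A, B, C, D, F, E] = - eps [A, B, C, D, E, F]" for C D
      using eps_swap[of 1 "[A, B, C, D, E, F]" 4] eps_swap[of 4 "[A, B, C, D, E, F]" 5] by simp_all
    then show "T A E B F = - T A B E F" "T A B F E = - T A B E F"
      unfolding T_def by (simp_all only: mult_minus_left sum_negf)
  qed
  have "dZ6 xi Z 0 $$ (A, B) * cnj (Z $$ (A, B))
      = 1/4 * (\<Sum>E<6. \<Sum>F<6. T A B E F * cnj (Z $$ (A, B)) * cnj (Z $$ (E, F)))"
    if "A < 6" "B < 6" for A B
  proof -
    define g where "g = (\<lambda>C D E F. eps [A, B, C, D, E, F] * cnj (xi $$ (C, D)) * cnj (Z $$ (E, F)))"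
    have "(\<Sum>C<6. \<Sum>D<6. \<Sum>E<6. \<Sum>F<6. g C D E F) = (\<Sum>C<6. \<Sum>E<6. \<Sum>F<6. \<Sum>D<6. g C D E F)"
      by (rule sum.cong[OF refl], rule trans[OF sum.swap], rule sum.cong[OF refl], rule sum.swap)
    also have "\<dots> = (\<Sum>E<6. \<Sum>F<6. \<Sum>C<6. \<Sum>D<6. g C D E F)"
      by (rule trans[OF sum.swap], rule sum.cong[OF refl], rule sum.swap)
    finally have "dZ6 xi Z 0 $$ (A, B) = 1/4 * (\<Sum>E<6. \<Sum>F<6. T A B E F * cnj (Z $$ (E, F)))"
      using that by (simp add: dZ6_def T_def g_def sum_distrib_right)
    then show ?thesis
      by (simp add: sum_distrib_left sum_distrib_right mult_ac)
  qed
  then have "(\<Sum>A<6. \<Sum>B<6. dZ6 xi Z 0 $$ (A, B) * cnj (Z $$ (A, B)))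
      = 1/4 * (\<Sum>A<6. \<Sum>B<6. \<Sum>E<6. \<Sum>F<6. T A B E F * cnj (Z $$ (A, B)) * cnj (Z $$ (E, F)))"
    unfolding sum_distrib_left by simp
  also have "\<dots> = 0"
    using antisym_contract_single_skew(2)[OF skew Z, of T, OF T] by simp
  finally show "(\<Sum>A<6. \<Sum>B<6. dZ6 xi Z 0 $$ (A, B) * cnj (Z $$ (A, B))) = 0" .
qed

text \<open>The parameters \<open>xi\<close> themselves serve as the antisymmetric tensor contracted
  with two copies of the conjugate of \<open>Z\<close>.\<close>

lemma stationary8:
  assumes skew: "single_skew_eigenvalue 8 Z z1" and Z: "Z \<in> carrier_mat 8 8"
    and xi: "params8 xi"
  shows "((\<lambda>t. V_grav (Z + of_real t \<cdot>\<^sub>m dZ8 xi Z)) has_vector_derivative 0) (at 0)"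
proof (rule V_grav_stationary[OF Z])
  show "dZ8 xi Z \<in> carrier_mat 8 8"
    by (simp add: dZ8_def)
  have anti: "xi A C B D = - xi A B C D" "xi A B D C = - xi A B C D"
    if "A < 8" "B < 8" "C < 8" "D < 8" for A B C D
    using xi that unfolding params8_def by blast+
  have "(\<Sum>A<8. \<Sum>B<8. dZ8 xi Z $$ (A, B) * cnj (Z $$ (A, B)))
      = 1/2 * (\<Sum>A<8. \<Sum>B<8. \<Sum>C<8. \<Sum>D<8. xi A B C D * cnj (Z $$ (A, B)) * cnj (Z $$ (C, D)))"
    by (simp add: dZ8_def sum_distrib_left sum_distrib_right mult_ac)
  also have "(\<Sum>A<8. \<Sum>B<8. \<Sum>C<8. \<Sum>D<8. xi A B C D * cnj (Z $$ (A, B)) * cnj (Z $$ (C, D))) = 0"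
    by (rule antisym_contract_single_skew(2)[OF skew Z]) (rule anti; assumption)+
  finally show "(\<Sum>A<8. \<Sum>B<8. dZ8 xi Z $$ (A, B) * cnj (Z $$ (A, B))) = 0"
    by simp
qed

text \<open>The Pluecker relations make the Pfaffian vanish, which reduces the radicand to its trace
  part.\<close>

lemma S8_single_skew:
  assumes skew: "single_skew_eigenvalue 8 Z z1" and Z: "Z \<in> carrier_mat 8 8"
  shows "S8 Z = V_grav Z"
proof -
  have "Pf Z = 0"
    using Z single_skew_eigenvalue_pluecker[OF skew Z] by (intro Pf_pluecker[of _ 4]) auto
  then show ?thesis
    using half_csqrt_trace_single_skew[OF skew Z] by (simp add: S8_def)
qed

theorem mainTheorem7:
  shows "(\<forall>(n::nat) (z::complex vec) (W::complex vec) (Z1::complex).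
      z \<in> carrier_vec 3 \<and> single_skew_eigenvalue 3 (Zmat3 z) Z1 \<and> W = 0\<^sub>v n \<longrightarrow>
      (\<forall>xi \<in> carrier_mat 3 n.
         ((\<lambda>t::real. V_matter (Zmat3 (z + of_real t \<cdot>\<^sub>v dZ3 xi W)) (W + of_real t \<cdot>\<^sub>v dW3 xi z))
            has_vector_derivative 0) (at 0)) \<and>
      S3 z W = V_matter (Zmat3 z) W \<and> V_matter (Zmat3 z) W = of_real ((cmod Z1)\<^sup>2)) \<and>
    (\<forall>(n::nat) (Z::complex mat) (W::complex vec) (Z1::complex).
      antisym_mat 4 Z \<and> single_skew_eigenvalue 4 Z Z1 \<and> W = 0\<^sub>v n \<longrightarrow>
      (\<forall>xi eta. matter_params4 n eta \<longrightarrow>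
         ((\<lambda>t::real. V_matter (Z + of_real t \<cdot>\<^sub>m dZ4 xi eta Z W) (W + of_real t \<cdot>\<^sub>v dW4 xi eta Z W))
            has_vector_derivative 0) (at 0)) \<and>
      S4 Z W = V_matter Z W \<and> V_matter Z W = of_real ((cmod Z1)\<^sup>2)) \<and>
    (\<forall>(Z::complex mat) (Z1::complex).
      antisym_mat 5 Z \<and> single_skew_eigenvalue 5 Z Z1 \<longrightarrow>
      (\<forall>xi \<in> carrier_vec 5.
         ((\<lambda>t::real. V_grav (Z + of_real t \<cdot>\<^sub>m dZ5 xi Z)) has_vector_derivative 0) (at 0)) \<and>
      S5 Z = V_grav Z \<and> V_grav Z = of_real ((cmod Z1)\<^sup>2)) \<and>
    (\<forall>(Z::complex mat) (X::complex) (Z1::complex).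
      antisym_mat 6 Z \<and> single_skew_eigenvalue 6 Z Z1 \<and> X = 0 \<longrightarrow>
      (\<forall>xi. antisym_mat 6 xi \<longrightarrow>
         ((\<lambda>t::real. V_singlet (Z + of_real t \<cdot>\<^sub>m dZ6 xi Z X) (X + of_real t * dX6 xi Z))
            has_vector_derivative 0) (at 0)) \<and>
      S6 Z X = V_singlet Z X \<and> V_singlet Z X = of_real ((cmod Z1)\<^sup>2)) \<and>
    (\<forall>(Z::complex mat) (Z1::complex).
      antisym_mat 8 Z \<and> single_skew_eigenvalue 8 Z Z1 \<longrightarrow>
      (\<forall>xi. params8 xi \<longrightarrow>
         ((\<lambda>t::real. V_grav (Z + of_real t \<cdot>\<^sub>m dZ8 xi Z)) has_vector_derivative 0) (at 0)) \<and>
      S8 Z = V_grav Z \<and> V_grav Z = of_real ((cmod Z1)\<^sup>2))"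
  (is "?N3 \<and> ?N4 \<and> ?N5 \<and> ?N6 \<and> ?N8")
proof -
  have carrier: "Z \<in> carrier_mat N N" if "antisym_mat N Z" for N Z
    using that by (simp add: antisym_mat_def)
  have ?N3
    using stationary3 V_grav_single_skew[OF _ Zmat3_carrier]
    by (auto simp: V_matter_zero V_grav_Zmat3 S3_def)
  moreover have ?N4
    using stationary4 S4_single_skew V_grav_single_skew by (auto simp: V_matter_zero carrier)
  moreover have ?N5
    using stationary5 half_csqrt_trace_single_skew V_grav_single_skew
    by (auto simp: S5_def carrier)
  \<comment> \<open>Every term of the radicand beyond the traces carries a factor \<open>X\<close>,
    including the Pfaffian term, so at \<open>X = 0\<close> the trace part remains.\<close>
  moreover have ?N6
    using stationary6 half_csqrt_trace_single_skew V_grav_single_skew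
    by (auto simp: S6_def V_singlet_def carrier)
  moreover have ?N8
    using stationary8 S8_single_skew V_grav_single_skew by (auto simp: carrier)
  ultimately show ?thesis
    by (intro conjI)
qed

end
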